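(* Let $G$ be a hidden graph on vertex set $V$ accessible via an MIS oracle, and let $S\subseteq V$. The connected components of $G[S]$ can be computed with $\mathcal{O}(|S|^2)$ MIS queries, and there are instances where $\Omega(|S|^2)$ MIS queries are needed.
   Context: A maximal independent set (MIS) oracle for a graph $G$ on $V$, on query $T\subseteq V$, returns some maximal independent set of the induced subgraph $G[T]$, which may be chosen adversarially among all maximal independent sets of $G[T]$. Computing the connected components of $G[S]$ means outputting the partition of $S$ into the vertex sets of the connected components of $G[S]$, guaranteed correct from the query answers alone. *)

theory Defs
  imports Complex_Main
begin

definition simple_graph :: "'a set \<Rightarrow> 'a rel \<Rightarrow> bool" where
  "simple_graph V E \<longleftrightarrow> finite V \<and> E \<subseteq> V \<times> V \<and> sym E \<and> irrefl E"

definition induced_edges :: "'a rel \<Rightarrow> 'a set \<Rightarrow> 'a rel" where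
  "induced_edges E T = E \<inter> (T \<times> T)"

definition independent_set :: "'a set \<Rightarrow> 'a rel \<Rightarrow> 'a set \<Rightarrow> bool" where
  "independent_set V E I \<longleftrightarrow> I \<subseteq> V \<and> (\<forall>u\<in>I. \<forall>v\<in>I. (u, v) \<notin> E)"

definition maximal_independent_set :: "'a set \<Rightarrow> 'a rel \<Rightarrow> 'a set \<Rightarrow> bool" where
  "maximal_independent_set V E I \<longleftrightarrow>
     independent_set V E I \<and> (\<forall>J. independent_set V E J \<and> I \<subseteq> J \<longrightarrow> J = I)"

definition connected_components :: "'a set \<Rightarrow> 'a rel \<Rightarrow> 'a set set" where
  "connected_components V E = V // {(u, v). u \<in> V \<and> v \<in> V \<and> (u, v) \<in> E\<^sup>*}"

text \<open>
  The answer of an oracle may depend on the query and on the earlier queries and their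
  answers (most recent first), so that repeating a query need not yield the same set.
\<close>

type_synonym 'a history = "('a set \<times> 'a set) list"
type_synonym 'a oracle_fun = "'a history \<Rightarrow> 'a set \<Rightarrow> 'a set"

definition mis_oracle :: "'a set \<Rightarrow> 'a rel \<Rightarrow> 'a oracle_fun \<Rightarrow> bool" where
  "mis_oracle V E orc \<longleftrightarrow>
     (\<forall>h T. T \<subseteq> V \<longrightarrow> maximal_independent_set T (induced_edges E T) (orc h T))"

text \<open>
  A deterministic adaptive algorithm is a decision tree: it either outputs a family of vertex
  sets, or makes a query and continues depending on the answer. Its only access to the graph
  is through the answers.
\<close>

datatype 'a algorithm =
    Output "'a set set"
  | Query "'a set" "'a set \<Rightarrow> 'a algorithm"

primrec queries_within :: "'a set \<Rightarrow> 'a algorithm \<Rightarrow> bool" where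
  "queries_within V (Output P) \<longleftrightarrow> True"
| "queries_within V (Query T k) \<longleftrightarrow> T \<subseteq> V \<and> (\<forall>A. queries_within V (k A))"

primrec output_from :: "'a algorithm \<Rightarrow> 'a oracle_fun \<Rightarrow> 'a history \<Rightarrow> 'a set set" where
  "output_from (Output P) orc h = P"
| "output_from (Query T k) orc h = output_from (k (orc h T)) orc ((T, orc h T) # h)"

primrec num_queries_from :: "'a algorithm \<Rightarrow> 'a oracle_fun \<Rightarrow> 'a history \<Rightarrow> nat" where
  "num_queries_from (Output P) orc h = 0"
| "num_queries_from (Query T k) orc h =
     Suc (num_queries_from (k (orc h T)) orc ((T, orc h T) # h))"

definition final_output :: "'a algorithm \<Rightarrow> 'a oracle_fun \<Rightarrow> 'a set set" where
  "final_output alg orc = output_from alg orc []"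

definition num_queries :: "'a algorithm \<Rightarrow> 'a oracle_fun \<Rightarrow> nat" where
  "num_queries alg orc = num_queries_from alg orc []"

text \<open>
  The algorithm may depend on \<open>V\<close> and \<open>S\<close>, but it must be correct for every graph on \<open>V\<close> and
  every way the oracle may answer.
\<close>

definition computes_components :: "'a set \<Rightarrow> 'a set \<Rightarrow> 'a algorithm \<Rightarrow> bool" where
  "computes_components V S alg \<longleftrightarrow>
     queries_within V alg \<and>
     (\<forall>E orc. simple_graph V E \<and> mis_oracle V E orc \<longrightarrow>
        final_output alg orc = connected_components S (induced_edges E S))"

end

theory Submission
  imports Defs
begin

text \<open>
  Upper bound: a query on a pair returns the whole pair iff it is a non-edge, so
  \<open>|S|\<^sup>2\<close> queries reveal \<open>G[S]\<close>.

  Lower bound: let \<open>G\<close> be the disjoint union of two cliques \<open>A\<close> and \<open>B\<close>. An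
  independent set contains at most one pair \<open>(a, b) \<in> A \<times> B\<close>. If no answer contains
  both \<open>a\<close> and \<open>b\<close>, then all answers remain maximal independent sets after the edge \<open>ab\<close> is
  added, so the algorithm cannot distinguish \<open>G\<close> from a connected graph. Hence each of the
  \<open>|A| |B|\<close> pairs needs its own query.
\<close>

section \<open>Maximal independent sets: existence and behaviour under added edges\<close>

lemma maximal_independent_set_exists:
  assumes "finite V"
  shows "\<exists>I. maximal_independent_set V E I"
proof -
  let ?F = "{I. independent_set V E I}"
  have "finite ?F"
    by (rule finite_subset[of _ "Pow V"]) (auto simp: independent_set_def assms)
  moreover have "{} \<in> ?F"
    by (simp add: independent_set_def)
  ultimately have "\<exists>I\<in>?F. \<forall>J\<in>?F. I \<subseteq> J \<longrightarrow> I = J"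
    by (intro finite_has_maximal) auto
  then obtain I where I: "independent_set V E I" "\<And>J. independent_set V E J \<Longrightarrow> I \<subseteq> J \<Longrightarrow> I = J"
    by auto
  have "maximal_independent_set V E I"
    unfolding maximal_independent_set_def using I(1) I(2)[symmetric] by simp
  then show ?thesis ..
qed

text \<open>Added edges only remove independent sets, so no new competitor above \<open>I\<close>
  can appear.\<close>

lemma maximal_independent_set_more_edges:
  assumes "maximal_independent_set V E I" "E \<subseteq> E'" "independent_set V E' I"
  shows "maximal_independent_set V E' I"
  unfolding maximal_independent_set_def
proof (intro conjI allI impI)
  show "independent_set V E' I"
    by (fact assms(3))
  fix J assume "independent_set V E' J \<and> I \<subseteq> J"
  then have "independent_set V E J" "I \<subseteq> J"
    using assms(2) by (auto simp: independent_set_def)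
  then show "J = I"
    using assms(1) by (simp add: maximal_independent_set_def)
qed

section \<open>Upper bound: probing pairs\<close>

lemma pair_query:
  assumes "simple_graph V E" "maximal_independent_set {u, v} (induced_edges E {u, v}) I"
  shows "{u, v} \<subseteq> I \<longleftrightarrow> (u, v) \<notin> E"
proof -
  have ind: "independent_set {u, v} (induced_edges E {u, v}) I"
    using assms(2) by (simp add: maximal_independent_set_def)
  show ?thesis
  proof
    assume "{u, v} \<subseteq> I"
    then show "(u, v) \<notin> E"
      using ind by (auto simp: independent_set_def induced_edges_def)
  next
    assume "(u, v) \<notin> E"
    \<comment> \<open>Symmetry excludes \<open>(v, u)\<close>, and irreflexivity excludes loops,
      which also covers \<open>u = v\<close>.\<close>
    then have "independent_set {u, v} (induced_edges E {u, v}) {u, v}"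
      using assms(1)
      by (auto simp: simple_graph_def independent_set_def induced_edges_def irrefl_def dest: symD)
    moreover have "I \<subseteq> {u, v}"
      using ind by (simp add: independent_set_def)
    ultimately have "{u, v} = I"
      using assms(2) by (simp add: maximal_independent_set_def)
    then show "{u, v} \<subseteq> I"
      by simp
  qed
qed

text \<open>\<open>F\<close> accumulates the edges found so far. Only the orientation being probed
  is inserted; the reverse one is found when \<open>(v, u)\<close> is probed.\<close>

fun probe :: "'a set \<Rightarrow> ('a \<times> 'a) list \<Rightarrow> 'a rel \<Rightarrow> 'a algorithm" where
  "probe S [] F = Output (connected_components S F)"
| "probe S ((u, v) # ps) F =
     Query {u, v} (\<lambda>I. probe S ps (if {u, v} \<subseteq> I then F else insert (u, v) F))"

lemma queries_within_probe: "set ps \<subseteq> V \<times> V \<Longrightarrow> queries_within V (probe S ps F)"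
  by (induction S ps F rule: probe.induct) auto

lemma num_queries_from_probe: "num_queries_from (probe S ps F) orc h = length ps"
  by (induction S ps F arbitrary: h rule: probe.induct) auto

text \<open>\<open>F\<close> and \<open>h\<close> are arbitrary because each query changes both:
  \<open>F\<close> gains exactly the probed pair if it is an edge, and the oracle may react to the
  history.\<close>

lemma output_from_probe:
  assumes "simple_graph V E" "mis_oracle V E orc" "set ps \<subseteq> V \<times> V"
  shows "output_from (probe S ps F) orc h = connected_components S (F \<union> E \<inter> set ps)"
  using assms(3)
proof (induction S ps F arbitrary: h rule: probe.induct)
  case (1 S F)
  then show ?case by simp
next
  case (2 S u v ps F)
  let ?F = "if {u, v} \<subseteq> orc h {u, v} then F else insert (u, v) F"
  have "{u, v} \<subseteq> orc h {u, v} \<longleftrightarrow> (u, v) \<notin> E"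
    using 2 assms by (intro pair_query[OF assms(1)]) (auto simp: mis_oracle_def)
  then have "?F \<union> E \<inter> set ps = F \<union> E \<inter> set ((u, v) # ps)"
    by auto
  then show ?case
    using "2.IH"[of "orc h {u, v}"] "2.prems"
    by (simp only: probe.simps output_from.simps) simp
qed

theorem components_upper_bound:
  assumes "finite V" "S \<subseteq> V"
  shows "\<exists>alg. computes_components V S alg \<and> (\<forall>orc. num_queries alg orc = (card S)\<^sup>2)"
proof -
  have fin: "finite S"
    using assms finite_subset by blast
  \<comment> \<open>All ordered pairs are listed, so both orientations of every edge in
    \<open>S\<close> are collected.\<close>
  then obtain ps where ps: "set ps = S \<times> S" "distinct ps"
    using finite_distinct_list[of "S \<times> S"] by auto
  then have "length ps = (card S)\<^sup>2"
    using distinct_card[of ps] by (simp add: card_cartesian_product power2_eq_square)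
  moreover have "set ps \<subseteq> V \<times> V"
    using ps assms by auto
  ultimately have "computes_components V S (probe S ps {}) \<and>
      (\<forall>orc. num_queries (probe S ps {}) orc = (card S)\<^sup>2)"
    using ps(1)
    by (auto simp: computes_components_def final_output_def num_queries_def induced_edges_def
        queries_within_probe num_queries_from_probe output_from_probe)
  then show ?thesis by blast
qed

section \<open>Transcripts of runs\<close>

primrec final_history :: "'a algorithm \<Rightarrow> 'a oracle_fun \<Rightarrow> 'a history \<Rightarrow> 'a history" where
  "final_history (Output P) orc h = h"
| "final_history (Query T k) orc h = final_history (k (orc h T)) orc ((T, orc h T) # h)"

lemma length_final_history:
  "length (final_history alg orc h) = num_queries_from alg orc h + length h"
  by (induction alg arbitrary: h) auto

lemma set_final_history_mono: "set h \<subseteq> set (final_history alg orc h)"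
proof (induction alg arbitrary: h)
  case (Query T k)
  show ?case
    using Query[of "k (orc h T)" "(T, orc h T) # h"] by simp
qed simp

text \<open>The history at which \<open>T\<close> was asked is forgotten; some \<open>h'\<close>
  suffices, since \<open>mis_oracle\<close> constrains the answers at every history.\<close>

lemma in_final_history:
  assumes "queries_within V alg" "(T, I) \<in> set (final_history alg orc h)"
  shows "(T, I) \<in> set h \<or> T \<subseteq> V \<and> (\<exists>h'. I = orc h' T)"
  using assms
proof (induction alg arbitrary: h)
  case (Query T' k)
  then show ?case
    using Query.IH[of "k (orc h T')" "(T', orc h T') # h"] by auto
qed simp

text \<open>By induction the two runs never diverge. Agreement is demanded at every
  \<open>h'\<close> that yields a recorded answer, so entries need not be matched with the moment of
  their query.\<close>

lemma output_from_cong: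
  assumes "\<And>h' T. (T, orc h' T) \<in> set (final_history alg orc h) \<Longrightarrow> orc' h' T = orc h' T"
  shows "output_from alg orc' h = output_from alg orc h"
  using assms
proof (induction alg arbitrary: h)
  case (Query T k)
  have "(T, orc h T) \<in> set (final_history (Query T k) orc h)"
    using set_final_history_mono[of "(T, orc h T) # h"] by auto
  then have "orc' h T = orc h T"
    by (rule Query.prems)
  then show ?case
    using Query by simp
qed simp

section \<open>Joining and separating vertices by components\<close>

lemma edge_in_component:
  assumes "(a, b) \<in> E" "a \<in> V" "b \<in> V"
  shows "\<exists>C\<in>connected_components V E. a \<in> C \<and> b \<in> C"
  unfolding connected_components_def
  by (rule bexI[OF _ quotientI[of a]]) (use assms in auto)

text \<open>All of \<open>C\<close> is reachable from one representative in \<open>V\<close>, and a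
  path starting in \<open>A\<close> or in \<open>B\<close> cannot leave that set.\<close>

lemma closed_sets_separate_components:
  assumes "C \<in> connected_components V E" "E `` A \<subseteq> A" "E `` B \<subseteq> B" "V \<subseteq> A \<union> B"
    "A \<inter> B = {}" "a \<in> A" "b \<in> B" "a \<in> C"
  shows "b \<notin> C"
proof
  assume "b \<in> C"
  then obtain u where "u \<in> V" "(u, a) \<in> E\<^sup>*" "(u, b) \<in> E\<^sup>*"
    using assms(1,8) unfolding connected_components_def by (auto elim!: quotientE)
  then show False
    using assms Image_closed_trancl[OF assms(2)] Image_closed_trancl[OF assms(3)] by blast
qed

section \<open>Lower bound: two disjoint cliques\<close>

definition two_cliques :: "'a set \<Rightarrow> 'a set \<Rightarrow> 'a rel" where
  "two_cliques A B = (A \<times> A \<union> B \<times> B) - Id"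

lemma simple_graph_two_cliques:
  "finite A \<Longrightarrow> finite B \<Longrightarrow> simple_graph (A \<union> B) (two_cliques A B)"
  by (auto simp: simple_graph_def two_cliques_def sym_def irrefl_def)

lemma pair_answered:
  assumes "finite A" "finite B" "A \<inter> B = {}" "a \<in> A" "b \<in> B"
    and orc: "mis_oracle (A \<union> B) (two_cliques A B) orc"
    and alg: "computes_components (A \<union> B) (A \<union> B) alg"
  shows "\<exists>(T, I)\<in>set (final_history alg orc []). a \<in> I \<and> b \<in> I"
proof (rule ccontr)
  assume unanswered: "\<not> ?thesis"
  define V where "V = A \<union> B"
  define E where "E = two_cliques A B"
  define E' where "E' = E \<union> {(a, b), (b, a)}"
  define mis' where "mis' T I \<longleftrightarrow> maximal_independent_set T (induced_edges E' T) I" for T I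
  \<comment> \<open>The old answer is kept wherever it is still legal. The fallback makes
    \<open>orc'\<close> a valid oracle also on queries that the run never makes.\<close>
  define orc' where "orc' h T = (if mis' T (orc h T) then orc h T else SOME I. mis' T I)" for h T
  have "finite V"
    using assms by (simp add: V_def)
  have "E \<subseteq> V \<times> V"
    by (auto simp: E_def V_def two_cliques_def)
  have graph: "simple_graph V E" "simple_graph V E'"
    using assms simple_graph_two_cliques[of A B]
    by (auto simp: V_def E_def E'_def simple_graph_def sym_def irrefl_def)
  have "mis' T (orc' h T)" if "T \<subseteq> V" for h T
  proof -
    have "\<exists>I. mis' T I"
      using that \<open>finite V\<close> maximal_independent_set_exists finite_subset
      unfolding mis'_def by blast
    then have "mis' T (SOME I. mis' T I)"
      by (rule someI_ex)
    then show ?thesis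
      by (simp add: orc'_def)
  qed
  then have orc': "mis_oracle V E' orc'"
    by (simp add: mis_oracle_def mis'_def)
  \<comment> \<open>On recorded answers the fallback is never taken.\<close>
  have "orc' h T = orc h T" if "(T, orc h T) \<in> set (final_history alg orc [])" for h T
  proof -
    have "T \<subseteq> V"
      using in_final_history[OF _ that] alg by (auto simp: computes_components_def V_def)
    then have mis: "maximal_independent_set T (induced_edges E T) (orc h T)"
      using orc by (simp add: mis_oracle_def V_def E_def)
    have "\<not> (a \<in> orc h T \<and> b \<in> orc h T)"
      using unanswered that by blast
    moreover have "independent_set T (induced_edges E T) (orc h T)"
      using mis by (simp add: maximal_independent_set_def)
    \<comment> \<open>Only the two orientations of \<open>ab\<close> are new, and the answer misses
      \<open>a\<close> or \<open>b\<close>.\<close>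
    ultimately have "independent_set T (induced_edges E' T) (orc h T)"
      unfolding independent_set_def induced_edges_def E'_def by blast
    then have "mis' T (orc h T)"
      using mis unfolding mis'_def
      by (rule maximal_independent_set_more_edges[rotated 2]) (auto simp: induced_edges_def E'_def)
    then show ?thesis
      by (simp add: orc'_def)
  qed
  then have "final_output alg orc' = final_output alg orc"
    unfolding final_output_def by (rule output_from_cong)
  moreover have "induced_edges E V = E" "induced_edges E' V = E'"
    using graph by (auto simp: induced_edges_def simple_graph_def)
  ultimately have "connected_components V E' = connected_components V E"
    using alg orc orc' graph by (auto simp: computes_components_def V_def E_def)
  \<comment> \<open>In \<open>E'\<close> the new edge puts \<open>a\<close> and \<open>b\<close>
    into one component, while in \<open>E\<close> the closed sets \<open>A\<close> and
    \<open>B\<close> keep them apart.\<close>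
  moreover obtain C where "C \<in> connected_components V E'" "a \<in> C" "b \<in> C"
    using edge_in_component[of a b E' V] assms by (auto simp: E'_def V_def)
  moreover have "E `` A \<subseteq> A" "E `` B \<subseteq> B"
    using assms(3) by (auto simp: E_def two_cliques_def)
  ultimately show False
    using closed_sets_separate_components[of C V E A B a b] assms by (auto simp: V_def)
qed

theorem components_lower_bound:
  assumes "finite A" "finite B" "A \<inter> B = {}"
    and orc: "mis_oracle (A \<union> B) (two_cliques A B) orc"
    and alg: "computes_components (A \<union> B) (A \<union> B) alg"
  shows "card A * card B \<le> num_queries alg orc"
proof -
  let ?H = "set (final_history alg orc [])"
  have "\<forall>p\<in>A \<times> B. \<exists>q\<in>?H. fst p \<in> snd q \<and> snd p \<in> snd q"
  proof
    fix p assume "p \<in> A \<times> B"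
    then have "fst p \<in> A" "snd p \<in> B"
      by auto
    from pair_answered[OF assms(1-3) this orc alg]
    show "\<exists>q\<in>?H. fst p \<in> snd q \<and> snd p \<in> snd q"
      by (simp add: case_prod_beta)
  qed
  \<comment> \<open>Choose for each pair a transcript entry that witnesses it; counting reduces to
    the injectivity of this choice.\<close>
  then have "\<exists>f. \<forall>p\<in>A \<times> B. f p \<in> ?H \<and> fst p \<in> snd (f p) \<and> snd p \<in> snd (f p)"
    unfolding Bex_def by (rule bchoice)
  then obtain f where "\<forall>p\<in>A \<times> B. f p \<in> ?H \<and> fst p \<in> snd (f p) \<and> snd p \<in> snd (f p)"
    by (rule exE)
  then have f: "f p \<in> ?H" "fst p \<in> snd (f p)" "snd p \<in> snd (f p)" if "p \<in> A \<times> B" for p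
    using that by (simp_all only: Ball_def)
  have ind: "independent_set T (induced_edges (two_cliques A B) T) I"
    if "(T, I) \<in> ?H" for T I
  proof -
    have "queries_within (A \<union> B) alg"
      using alg by (simp add: computes_components_def)
    from in_final_history[OF this that] obtain h where "T \<subseteq> A \<union> B" "I = orc h T"
      by auto
    then show ?thesis
      using orc by (simp add: mis_oracle_def maximal_independent_set_def)
  qed
  \<comment> \<open>Distinct vertices of one clique are adjacent, so an answer meets each clique at
    most once and thus determines its pair.\<close>
  have unique: "x = y" if "q \<in> ?H" "x \<in> snd q" "y \<in> snd q" "x \<in> A \<and> y \<in> A \<or> x \<in> B \<and> y \<in> B" for q x y
  proof (rule ccontr)
    assume "x \<noteq> y"
    have "independent_set (fst q) (induced_edges (two_cliques A B) (fst q)) (snd q)"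
      using ind[of "fst q" "snd q"] that(1) by simp
    with that(2,3) have "x \<in> fst q" "y \<in> fst q" "(x, y) \<notin> induced_edges (two_cliques A B) (fst q)"
      unfolding independent_set_def by blast+
    then show False
      using that(4) \<open>x \<noteq> y\<close> by (auto simp: induced_edges_def two_cliques_def)
  qed
  have "inj_on f (A \<times> B)"
  proof (rule inj_onI)
    fix p p' assume p: "p \<in> A \<times> B" "p' \<in> A \<times> B" "f p = f p'"
    show "p = p'"
    proof (rule prod_eqI)
      show "fst p = fst p'"
        using p f[OF p(1)] f[OF p(2)] by (intro unique[of "f p"]) auto
      show "snd p = snd p'"
        using p f[OF p(1)] f[OF p(2)] by (intro unique[of "f p"]) auto
    qed
  qed
  then have "card (A \<times> B) \<le> card ?H"
    using f by (intro card_inj_on_le) auto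
  \<comment> \<open>Equal entries may recur in the transcript, so the set gives only a lower bound
    on its length.\<close>
  also have "\<dots> \<le> length (final_history alg orc [])"
    by (rule card_length)
  also have "\<dots> = num_queries alg orc"
    by (simp add: length_final_history num_queries_def)
  finally show ?thesis
    by (simp add: card_cartesian_product)
qed

section \<open>Quadratic bounds with explicit constants\<close>

theorem theorem16:
  "(\<exists>C::real. \<forall>V S :: 'a set. finite V \<and> S \<subseteq> V \<longrightarrow>
      (\<exists>alg. computes_components V S alg \<and>
        (\<forall>E orc. simple_graph V E \<and> mis_oracle V E orc \<longrightarrow>
           real (num_queries alg orc) \<le> C * (real (card S))\<^sup>2)))
   \<and> (\<exists>c>0::real. \<exists>n0::nat. \<forall>n\<ge>n0. \<exists>(V :: nat set) E S orc.
        simple_graph V E \<and> mis_oracle V E orc \<and> S \<subseteq> V \<and> card S = n \<and>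
        (\<forall>alg. computes_components V S alg \<longrightarrow>
           real (num_queries alg orc) \<ge> c * (real (card S))\<^sup>2))"
proof (rule conjI)
  have "\<exists>alg. computes_components V S alg \<and>
      (\<forall>E orc. simple_graph V E \<and> mis_oracle V E orc \<longrightarrow>
         real (num_queries alg orc) \<le> 1 * (real (card S))\<^sup>2)"
    if VS: "finite V \<and> S \<subseteq> V" for V S :: "'a set"
  proof -
    obtain alg where "computes_components V S alg" "\<forall>orc. num_queries alg orc = (card S)\<^sup>2"
      using components_upper_bound VS by blast
    then show ?thesis
      by (intro exI[of _ alg]) simp
  qed
  then show "\<exists>C::real. \<forall>V S :: 'a set. finite V \<and> S \<subseteq> V \<longrightarrow>
      (\<exists>alg. computes_components V S alg \<and>
        (\<forall>E orc. simple_graph V E \<and> mis_oracle V E orc \<longrightarrow>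
           real (num_queries alg orc) \<le> C * (real (card S))\<^sup>2))"
    by (intro exI[of _ 1]) blast
next
  have "\<exists>(V :: nat set) E S orc.
      simple_graph V E \<and> mis_oracle V E orc \<and> S \<subseteq> V \<and> card S = n \<and>
      (\<forall>alg. computes_components V S alg \<longrightarrow>
         real (num_queries alg orc) \<ge> 1 / 8 * (real (card S))\<^sup>2)"
    if "n \<ge> 2" for n
  proof -
    \<comment> \<open>A balanced split maximizes \<open>card A * card B\<close>; for odd
      \<open>n\<close> the extra vertex goes to \<open>B\<close>.\<close>
    define m where "m = n div 2"
    define A where "A = {..<m}"
    define B where "B = {m..<n}"
    define E where "E = two_cliques A B"
    \<comment> \<open>The lower bound holds against every valid oracle, so a history-independent
      choice suffices.\<close>
    define orc :: "nat oracle_fun"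
      where "orc h T = (SOME I. maximal_independent_set T (induced_edges E T) I)" for h T
    have fin: "finite A" "finite B" and disj: "A \<inter> B = {}" and card: "card (A \<union> B) = n"
      by (auto simp: A_def B_def m_def ivl_disj_un)
    have orc: "mis_oracle (A \<union> B) E orc"
      unfolding mis_oracle_def
    proof (intro allI impI)
      fix h T assume "T \<subseteq> A \<union> B"
      then have "finite T"
        using fin finite_subset by blast
      then show "maximal_independent_set T (induced_edges E T) (orc h T)"
        unfolding orc_def by (rule someI_ex[OF maximal_independent_set_exists])
    qed
    have bound: "1 / 8 * (real n)\<^sup>2 \<le> real (card A * card B)"
    proof -
      \<comment> \<open>For \<open>n = 2 * m\<close> this is 4mm \<le> 8mm. For
        \<open>n = 2 * m + 1\<close> it is 4m(m+1) + 1 \<le> 8m(m+1), which holds since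
        \<open>n \<ge> 2\<close> gives \<open>m \<ge> 1\<close>.\<close>
      have "n * n \<le> 8 * (m * (n - m))"
      proof -
        have "m \<ge> 1" "n = 2 * m \<or> n = 2 * m + 1"
          using that by (auto simp: m_def)
        moreover have "m \<le> m * m"
          by simp
        ultimately show ?thesis
          by (auto simp: algebra_simps)
      qed
      then have "real (n * n) \<le> real (8 * (m * (n - m)))"
        by (simp only: of_nat_le_iff)
      then show ?thesis
        by (simp add: A_def B_def power2_eq_square)
    qed
    have "1 / 8 * (real (card (A \<union> B)))\<^sup>2 \<le> real (num_queries alg orc)"
      if "computes_components (A \<union> B) (A \<union> B) alg" for alg
    proof -
      have "real (card A * card B) \<le> real (num_queries alg orc)"
        using components_lower_bound[OF fin disj orc[unfolded E_def] that] by (rule of_nat_mono)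
      then show ?thesis
        using bound card by simp
    qed
    moreover have "simple_graph (A \<union> B) E"
      unfolding E_def by (rule simple_graph_two_cliques[OF fin])
    ultimately show ?thesis
      using orc card by (intro exI[of _ "A \<union> B"] exI[of _ E] exI[of _ orc]) simp
  qed
  then show "\<exists>c>0::real. \<exists>n0::nat. \<forall>n\<ge>n0. \<exists>(V :: nat set) E S orc.
      simple_graph V E \<and> mis_oracle V E orc \<and> S \<subseteq> V \<and> card S = n \<and>
      (\<forall>alg. computes_components V S alg \<longrightarrow>
         real (num_queries alg orc) \<ge> c * (real (card S))\<^sup>2)"
    by (intro exI[of _ "1 / 8"] conjI exI[of _ 2] allI impI) simp_all
qed

end
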